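(* A division ring $D$ is a strongly $\sqrt{J}$-clean ring if and only if $D\cong\mathbb{F}_2$.
   Context: Rings are associative with identity $1\neq 0$ (not necessarily commutative). $J(R)$ is the Jacobson radical of $R$, and $\sqrt{J(R)}=\{z\in R : z^n\in J(R)\text{ for some } n\ge 1\}$. A ring $R$ is strongly $\sqrt{J}$-clean if every $x\in R$ can be written as $x=e+z$ with $e$ an idempotent of $R$, $z\in\sqrt{J(R)}$ and $ez=ze$. $\mathbb{F}_2$ is the field with two elements. *)

theory Defs
  imports "HOL-Algebra.QuotRing" "HOL-Number_Theory.Residues"
begin

text \<open>HOL-Algebra's \<open>ring\<close> is associative and unital, but not necessarily
  commutative, and it includes the zero ring.\<close>

locale nonzero_ring = ring +
  assumes one_not_zero: "\<one> \<noteq> \<zero>"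

text \<open>The name avoids a clash with the type class \<open>division_ring\<close>.
  \<open>Units\<close> are the elements with a two-sided inverse.\<close>

locale skew_field = nonzero_ring +
  assumes skew_field_Units: "Units R = carrier R - {\<zero>}"

text \<open>HOL-Algebra's \<open>ideal\<close> and \<open>maximalideal\<close> are two-sided; over a
  noncommutative ring the Jacobson radical needs the one-sided versions.\<close>

locale left_ideal = additive_subgroup I R + ring R for I and R (structure) +
  assumes I_l_closed: "\<lbrakk>a \<in> I; x \<in> carrier R\<rbrakk> \<Longrightarrow> x \<otimes> a \<in> I"

locale maximal_left_ideal = left_ideal +
  assumes I_notcarr: "carrier R \<noteq> I"
    and I_maximal: "\<lbrakk>left_ideal J R; I \<subseteq> J; J \<subseteq> carrier R\<rbrakk> \<Longrightarrow> J = I \<or> J = carrier R"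

definition jacobson_radical :: "('a, 'm) ring_scheme \<Rightarrow> 'a set" where
  "jacobson_radical R = {x \<in> carrier R. \<forall>I. maximal_left_ideal I R \<longrightarrow> x \<in> I}"

definition sqrt_jacobson_radical :: "('a, 'm) ring_scheme \<Rightarrow> 'a set" where
  "sqrt_jacobson_radical R =
     {z \<in> carrier R. \<exists>n::nat. n \<ge> 1 \<and> z [^]\<^bsub>R\<^esub> n \<in> jacobson_radical R}"

locale strongly_sqrtJ_clean_ring = nonzero_ring +
  assumes strongly_sqrtJ_clean:
    "x \<in> carrier R \<Longrightarrow>
       \<exists>e\<in>carrier R. \<exists>z\<in>sqrt_jacobson_radical R.
         e \<otimes> e = e \<and> x = e \<oplus> z \<and> e \<otimes> z = z \<otimes> e"

end

theory Submission
  imports Defs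
begin

text \<open>
  In a division ring the only left ideals are the zero ideal and the whole ring, so the zero ideal
  is a maximal left ideal and the Jacobson radical vanishes. As nonzero elements are units, nothing
  nonzero is nilpotent either, and \<open>sqrt_jacobson_radical\<close> vanishes too. Strong
  \<open>\<surd>J\<close>-cleanness therefore says that every element is idempotent. Cancelling units
  shows that the only idempotents are \<open>\<zero>\<close> and \<open>\<one>\<close>, so the condition holds exactly
  for the division rings with two elements (\<open>strongly_sqrtJ_clean_iff_two_elements\<close>),
  and up to isomorphism there is only one of these (\<open>iso_F2_iff_two_elements\<close>).
\<close>

context skew_field
begin

lemma nonzero_Units: "x \<in> carrier R \<Longrightarrow> x \<noteq> \<zero> \<Longrightarrow> x \<in> Units R"
  by (simp add: skew_field_Units)

lemma nilpotent_zero: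
  assumes z: "z \<in> carrier R" and pow: "z [^] (n::nat) = \<zero>"
  shows "z = \<zero>"
proof (rule ccontr)
  assume "z \<noteq> \<zero>"
  then have "z [^] n \<in> Units R"
    using z by (simp add: nonzero_Units Units_pow_closed)
  then show False
    using pow by (simp add: skew_field_Units)
qed

lemma idempotent_zero_or_one:
  assumes e: "e \<in> carrier R" and idem: "e \<otimes> e = e"
  shows "e = \<zero> \<or> e = \<one>"
proof (cases "e = \<zero>")
  case False
  then have "e \<in> Units R"
    by (simp add: e nonzero_Units)
  moreover have "e \<otimes> e = e \<otimes> \<one>"
    by (simp add: e idem)
  ultimately have "e = \<one>"
    using Units_l_cancel e by blast
  then show ?thesis ..
qed simp

text \<open>
  A nonzero element of a left ideal is a unit, and multiplying it on the left by its inverse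
  puts \<open>\<one>\<close> into the ideal.
\<close>

lemma left_ideal_trivial:
  assumes "left_ideal J R"
  shows "J = {\<zero>} \<or> J = carrier R"
proof (cases "J = {\<zero>}")
  case False
  interpret J: left_ideal J R by fact
  obtain x where x: "x \<in> J" "x \<noteq> \<zero>"
    using False J.zero_closed by blast
  then have unit: "x \<in> Units R"
    using J.a_subset nonzero_Units by blast
  then have one: "\<one> \<in> J"
    using J.I_l_closed[OF x(1), of "inv x"] by (simp add: Units_inv_closed Units_l_inv)
  have "y \<in> J" if "y \<in> carrier R" for y
    using J.I_l_closed[OF one that] that by simp
  then show ?thesis
    using J.a_subset by blast
qed simp

lemma maximal_left_ideal_zero: "maximal_left_ideal {\<zero>} R"
proof -
  have "additive_subgroup {\<zero>} R"
    by (rule additive_subgroup.intro) (unfold_locales, auto simp: a_inv_def[symmetric])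
  then have "left_ideal {\<zero>} R"
    by (intro left_ideal.intro left_ideal_axioms.intro) (auto intro: ring_axioms)
  then show ?thesis
    using left_ideal_trivial one_not_zero
    by (intro maximal_left_ideal.intro maximal_left_ideal_axioms.intro) auto
qed

lemma jacobson_radical_zero: "jacobson_radical R = {\<zero>}"
proof -
  have "\<zero> \<in> I" if "maximal_left_ideal I R" for I
    using that by (simp add: maximal_left_ideal_def left_ideal_def additive_subgroup.zero_closed)
  then show ?thesis
    using maximal_left_ideal_zero by (auto simp: jacobson_radical_def)
qed

lemma sqrt_jacobson_radical_zero: "sqrt_jacobson_radical R = {\<zero>}"
proof -
  have "\<zero> [^] (1::nat) = \<zero>"
    by simp
  then show ?thesis
    unfolding sqrt_jacobson_radical_def jacobson_radical_zero
    using nilpotent_zero by blast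
qed

lemma strongly_sqrtJ_clean_iff_two_elements:
  "strongly_sqrtJ_clean_ring R \<longleftrightarrow> carrier R = {\<zero>, \<one>}"
proof
  assume "strongly_sqrtJ_clean_ring R"
  then interpret strongly_sqrtJ_clean_ring R .
  have "x = \<zero> \<or> x = \<one>" if "x \<in> carrier R" for x
    using strongly_sqrtJ_clean[OF that] idempotent_zero_or_one
    by (auto simp: sqrt_jacobson_radical_zero)
  then show "carrier R = {\<zero>, \<one>}"
    by auto
next
  assume two: "carrier R = {\<zero>, \<one>}"
  have "\<exists>e\<in>carrier R. \<exists>z\<in>sqrt_jacobson_radical R.
      e \<otimes> e = e \<and> x = e \<oplus> z \<and> e \<otimes> z = z \<otimes> e" if "x \<in> carrier R" for x
    using that two by (intro bexI[of _ x] bexI[of _ \<zero>]) (auto simp: sqrt_jacobson_radical_zero)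
  then show "strongly_sqrtJ_clean_ring R"
    by unfold_locales
qed

end

lemma carrier_residue_ring_2: "carrier (residue_ring 2) = {0, 1}"
  by (auto simp: residue_ring_def)

text \<open>
  On two elements the ring axioms leave no choice in the operation tables: the only entry that
  they do not give directly is \<open>\<one> \<oplus> \<one>\<close>, and this is \<open>\<zero>\<close> because
  \<open>\<one> \<oplus> \<one> = \<one>\<close> would cancel to \<open>\<one> = \<zero>\<close>.
\<close>

lemma (in nonzero_ring) iso_F2_iff_two_elements:
  "R \<simeq> residue_ring 2 \<longleftrightarrow> carrier R = {\<zero>, \<one>}"
proof
  assume "R \<simeq> residue_ring 2"
  then obtain h where "bij_betw h (carrier R) (carrier (residue_ring 2))"
    by (auto simp: is_ring_iso_def ring_iso_def)
  then have "card (carrier R) = 2"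
    by (simp add: bij_betw_same_card carrier_residue_ring_2)
  moreover from this have "finite (carrier R)"
    using card.infinite by fastforce
  ultimately show "carrier R = {\<zero>, \<one>}"
    using one_not_zero by (intro card_subset_eq[symmetric]) auto
next
  assume two: "carrier R = {\<zero>, \<one>}"
  have "\<one> \<oplus> \<one> \<noteq> \<one>"
    using one_not_zero add.l_cancel_one by blast
  then have char: "\<one> \<oplus> \<one> = \<zero>"
    using two add.m_closed[OF one_closed one_closed] by auto
  let ?h = "\<lambda>x. if x = \<zero> then 0 else 1 :: int"
  have "?h \<in> ring_iso R (residue_ring 2)"
  proof (rule ring_iso_memI)
    show "bij_betw ?h (carrier R) (carrier (residue_ring 2))"
      using one_not_zero by (auto simp: two carrier_residue_ring_2 bij_betw_def)
  qed (use one_not_zero char two in \<open>auto simp: residue_ring_def\<close>)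
  then show "R \<simeq> residue_ring 2"
    by (auto simp: is_ring_iso_def)
qed

theorem lemma3p7:
  fixes D :: "('a, 'm) ring_scheme"
  assumes "skew_field D"
  shows "strongly_sqrtJ_clean_ring D \<longleftrightarrow> D \<simeq> residue_ring 2"
proof -
  interpret skew_field D by fact
  show ?thesis
    by (simp add: strongly_sqrtJ_clean_iff_two_elements iso_F2_iff_two_elements)
qed

end
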